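(* Let $\rho$ be an inheritable basic hyperparameter. Then for every integer $c$ and every graph class $\mathcal G$: (1) if $\mathcal G$ has bounded $\mu_{\rho,c}$, then $\mathcal G$ has bounded $\rho$; (2) if $\mathcal G$ has bounded $\alpha\text{-}\mu_{\rho,c}$, then $\mathcal G$ has bounded $\alpha\text{-}\rho$; (3) if $\mathcal G$ has clique-bounded $\mu_{\rho,c}$, then $\mathcal G$ has clique-bounded $\rho$.
   Context: All graphs are finite, simple and undirected; $\alpha,\omega$ denote independence and clique number. A graph class is a set of graphs closed under isomorphism. A hypergraph over $G$ is a nonempty set of subsets of $V(G)$; a hypermapping $\mathcal F$ assigns to each graph $G$ a finite nonempty family $\mathcal F_G$ of hypergraphs over $G$, compatibly with isomorphisms. For $\lambda\in\{\mathtt{card},\alpha\}$ with $\mathtt{card}(G,X)=|X|$ and $\alpha(G,X)=\alpha(G[X])$, and a basic hyperparameter $\rho=(\mathrm{opt},\mathcal F)$ with $\mathrm{opt}\in\{\mathrm{minmax},\mathrm{maxmin}\}$, define $\lambda\text{-}\rho(G)=\min_{H\in\mathcal F_G}\max_{X\in H}\lambda(G,X)$ if $\mathrm{opt}=\mathrm{minmax}$ and $\max_{H\in\mathcal F_G}\min_{X\in H}\lambda(G,X)$ if $\mathrm{opt}=\mathrm{maxmin}$; $\rho(G)=\mathtt{card}\text{-}\rho(G)$. $\rho$ is inheritable if for each $\lambda\in\{\mathtt{card},\alpha\}$, every graph $G$ and every $S\subseteq V(G)$, $\lambda\text{-}\rho(G)\le\rho(G-S)+\lambda(G,S)$. For an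 integer $c$, a $(\rho,c)$-modulator of $G$ is a set $S\subseteq V(G)$ with $\rho(G-S)\le c$; $\mu_{\rho,c}(G)$ is the minimum $|S|$ and $\alpha\text{-}\mu_{\rho,c}(G)$ the minimum $\alpha(G[S])$ over all $(\rho,c)$-modulators $S$. A class $\mathcal G$ has bounded $\sigma$ if there is an integer $k$ with $\sigma(G')\le k$ for every induced subgraph $G'$ of every $G\in\mathcal G$; it has clique-bounded $\sigma$ if there is a nondecreasing $f$ with $\sigma(G')\le f(\omega(G'))$ for all such $G'$. *)

theory Defs
  imports Main "HOL-Library.Extended_Nat"
begin

text \<open>Graphs are pairs of a vertex set and a set of two-element edges. The vertex type is a
  parameter; any infinite type represents every finite graph up to isomorphism.\<close>

type_synonym 'a graph = "'a set \<times> 'a set set"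

abbreviation verts :: "'a graph \<Rightarrow> 'a set" where
  "verts \<equiv> fst"

abbreviation edges :: "'a graph \<Rightarrow> 'a set set" where
  "edges \<equiv> snd"

definition finite_simple_graph :: "'a graph \<Rightarrow> bool" where
  "finite_simple_graph G \<longleftrightarrow> finite (verts G) \<and> (\<forall>e\<in>edges G. e \<subseteq> verts G \<and> card e = 2)"

definition induce :: "'a graph \<Rightarrow> 'a set \<Rightarrow> 'a graph" where
  "induce G X = (verts G \<inter> X, {e \<in> edges G. e \<subseteq> X})"

definition delete_verts :: "'a graph \<Rightarrow> 'a set \<Rightarrow> 'a graph" where
  "delete_verts G S = induce G (verts G - S)"

definition induced_subgraph :: "'a graph \<Rightarrow> 'a graph \<Rightarrow> bool" where
  "induced_subgraph G' G \<longleftrightarrow> (\<exists>X\<subseteq>verts G. G' = induce G X)"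

definition graph_iso :: "('a \<Rightarrow> 'a) \<Rightarrow> 'a graph \<Rightarrow> 'a graph \<Rightarrow> bool" where
  "graph_iso \<phi> G H \<longleftrightarrow> bij_betw \<phi> (verts G) (verts H) \<and>
     (\<forall>x\<in>verts G. \<forall>y\<in>verts G. {x, y} \<in> edges G \<longleftrightarrow> {\<phi> x, \<phi> y} \<in> edges H)"

definition graph_class :: "'a graph set \<Rightarrow> bool" where
  "graph_class \<G> \<longleftrightarrow> (\<forall>G\<in>\<G>. finite_simple_graph G) \<and>
     (\<forall>G\<in>\<G>. \<forall>H \<phi>. finite_simple_graph H \<and> graph_iso \<phi> G H \<longrightarrow> H \<in> \<G>)"

definition independent_set :: "'a graph \<Rightarrow> 'a set \<Rightarrow> bool" where
  "independent_set G X \<longleftrightarrow> X \<subseteq> verts G \<and> (\<forall>x\<in>X. \<forall>y\<in>X. {x, y} \<notin> edges G)"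

definition clique :: "'a graph \<Rightarrow> 'a set \<Rightarrow> bool" where
  "clique G X \<longleftrightarrow> X \<subseteq> verts G \<and> (\<forall>x\<in>X. \<forall>y\<in>X. x \<noteq> y \<longrightarrow> {x, y} \<in> edges G)"

definition independence_number :: "'a graph \<Rightarrow> nat" where
  "independence_number G = Max (card ` {X. independent_set G X})"

definition clique_number :: "'a graph \<Rightarrow> nat" where
  "clique_number G = Max (card ` {X. clique G X})"

definition hypergraph_over :: "'a graph \<Rightarrow> 'a set set \<Rightarrow> bool" where
  "hypergraph_over G H \<longleftrightarrow> H \<noteq> {} \<and> H \<subseteq> Pow (verts G)"

definition hypermapping :: "('a graph \<Rightarrow> 'a set set set) \<Rightarrow> bool" where
  "hypermapping \<F> \<longleftrightarrow>
     (\<forall>G. finite_simple_graph G \<longrightarrow>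
        finite (\<F> G) \<and> \<F> G \<noteq> {} \<and> (\<forall>H\<in>\<F> G. hypergraph_over G H)) \<and>
     (\<forall>G G' \<phi>. finite_simple_graph G \<and> finite_simple_graph G' \<and> graph_iso \<phi> G G' \<longrightarrow>
        \<F> G' = (\<lambda>H. (\<lambda>X. \<phi> ` X) ` H) ` \<F> G)"

definition card_measure :: "'a graph \<Rightarrow> 'a set \<Rightarrow> nat" where
  "card_measure G X = card X"

definition alpha_measure :: "'a graph \<Rightarrow> 'a set \<Rightarrow> nat" where
  "alpha_measure G X = independence_number (induce G X)"

datatype opt = Minmax | Maxmin

type_synonym 'a hyperparameter = "opt \<times> ('a graph \<Rightarrow> 'a set set set)"

definition basic_hyperparameter :: "'a hyperparameter \<Rightarrow> bool" where
  "basic_hyperparameter \<rho> \<longleftrightarrow> hypermapping (snd \<rho>)"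

definition hyper_value ::
  "('a graph \<Rightarrow> 'a set \<Rightarrow> nat) \<Rightarrow> 'a hyperparameter \<Rightarrow> 'a graph \<Rightarrow> nat" where
  "hyper_value m \<rho> G = (case \<rho> of (opt, \<F>) \<Rightarrow>
     (case opt of
        Minmax \<Rightarrow> Min ((\<lambda>H. Max (m G ` H)) ` \<F> G)
      | Maxmin \<Rightarrow> Max ((\<lambda>H. Min (m G ` H)) ` \<F> G)))"

abbreviation card_value :: "'a hyperparameter \<Rightarrow> 'a graph \<Rightarrow> nat" where
  "card_value \<equiv> hyper_value card_measure"

abbreviation alpha_value :: "'a hyperparameter \<Rightarrow> 'a graph \<Rightarrow> nat" where
  "alpha_value \<equiv> hyper_value alpha_measure"

definition inheritable :: "'a hyperparameter \<Rightarrow> bool" where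
  "inheritable \<rho> \<longleftrightarrow>
     (\<forall>m\<in>{card_measure, alpha_measure}. \<forall>G. finite_simple_graph G \<longrightarrow>
        (\<forall>S\<subseteq>verts G. hyper_value m \<rho> G \<le> card_value \<rho> (delete_verts G S) + m G S))"

definition modulator :: "'a hyperparameter \<Rightarrow> int \<Rightarrow> 'a graph \<Rightarrow> 'a set \<Rightarrow> bool" where
  "modulator \<rho> c G S \<longleftrightarrow> S \<subseteq> verts G \<and> int (card_value \<rho> (delete_verts G S)) \<le> c"

text \<open>For negative \<open>c\<close> there are no modulators, and the minimum is then \<open>\<infinity>\<close>.\<close>

definition mu :: "'a hyperparameter \<Rightarrow> int \<Rightarrow> 'a graph \<Rightarrow> enat" where
  "mu \<rho> c G = (INF S\<in>{S. modulator \<rho> c G S}. enat (card S))"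

definition alpha_mu :: "'a hyperparameter \<Rightarrow> int \<Rightarrow> 'a graph \<Rightarrow> enat" where
  "alpha_mu \<rho> c G =
     (INF S\<in>{S. modulator \<rho> c G S}. enat (independence_number (induce G S)))"

text \<open>Graph parameters are nonnegative, so a natural number serves as the integer bound.\<close>

definition has_bounded :: "'a graph set \<Rightarrow> ('a graph \<Rightarrow> enat) \<Rightarrow> bool" where
  "has_bounded \<G> \<sigma> \<longleftrightarrow>
     (\<exists>k::nat. \<forall>G\<in>\<G>. \<forall>G'. induced_subgraph G' G \<longrightarrow> \<sigma> G' \<le> enat k)"

definition has_clique_bounded :: "'a graph set \<Rightarrow> ('a graph \<Rightarrow> enat) \<Rightarrow> bool" where
  "has_clique_bounded \<G> \<sigma> \<longleftrightarrow>
     (\<exists>f::nat \<Rightarrow> nat. mono f \<and>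
        (\<forall>G\<in>\<G>. \<forall>G'. induced_subgraph G' G \<longrightarrow> \<sigma> G' \<le> enat (f (clique_number G'))))"

end

theory Submission
  imports Defs
begin

text \<open>Inheritability is used on each induced subgraph with \<open>S\<close> a modulator of it.
  Deleting \<open>S\<close> leaves a graph of \<rho>-value at most \<open>c\<close>, so the value of
  \<rho> under either measure exceeds that measure of \<open>S\<close> by at most \<open>c\<close>.
  Choosing \<open>S\<close> of small measure shows that passing from the modulator parameter to the
  hyperparameter costs only the additive constant \<open>nat c\<close>; this is
  \<open>hyper_value_le_modulator_bound\<close>. A constant shift preserves uniform bounds and
  bounds by a nondecreasing function of the clique number.\<close>

lemma finite_simple_graph_induced_subgraph:
  assumes "finite_simple_graph G" "induced_subgraph G' G"
  shows "finite_simple_graph G'"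
  using assms unfolding finite_simple_graph_def induced_subgraph_def induce_def by fastforce

text \<open>In \<open>inheritable\<close> the remainder \<open>delete_verts G S\<close> is measured
  by \<open>card_value\<close> whichever measure \<open>m\<close> is taken, and modulators are
  defined by the same \<open>card_value\<close>. One argument therefore serves both
  measures.\<close>

lemma hyper_value_le_modulator_bound:
  assumes inh: "inheritable \<rho>" and m: "m \<in> {card_measure, alpha_measure}"
    and G: "finite_simple_graph G"
    and k: "(INF S\<in>{S. modulator \<rho> c G S}. enat (m G S)) \<le> enat k"
  shows "hyper_value m \<rho> G \<le> nat c + k"
proof -
  \<comment> \<open>A strict bound on an infimum yields a member below it, hence the passage to
    \<open>Suc k\<close>. This also rules out the absence of modulators, where the infimum would be
    \<infinity>.\<close>
  have "(INF S\<in>{S. modulator \<rho> c G S}. enat (m G S)) < enat (Suc k)"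
    using k by (rule le_less_trans) simp
  then obtain S where S: "modulator \<rho> c G S" and "m G S \<le> k"
    by (auto simp: INF_less_iff)
  moreover have "hyper_value m \<rho> G \<le> card_value \<rho> (delete_verts G S) + m G S"
    using inh m G S unfolding inheritable_def modulator_def by blast
  \<comment> \<open>The existence of \<open>S\<close> forces \<open>c\<close> to be nonnegative, so
    \<open>nat c\<close> is \<open>c\<close> here.\<close>
  moreover have "card_value \<rho> (delete_verts G S) \<le> nat c"
    using S unfolding modulator_def by linarith
  ultimately show ?thesis by linarith
qed

lemma card_value_le_mu:
  assumes "inheritable \<rho>" "finite_simple_graph G" "mu \<rho> c G \<le> enat k"
  shows "card_value \<rho> G \<le> nat c + k"
  using hyper_value_le_modulator_bound[of \<rho> card_measure G c k] assms
  by (simp add: mu_def card_measure_def)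

lemma alpha_value_le_alpha_mu:
  assumes "inheritable \<rho>" "finite_simple_graph G" "alpha_mu \<rho> c G \<le> enat k"
  shows "alpha_value \<rho> G \<le> nat c + k"
  using hyper_value_le_modulator_bound[of \<rho> alpha_measure G c k] assms
  by (simp add: alpha_mu_def alpha_measure_def)

theorem theorem5p17:
  fixes \<rho> :: "'a hyperparameter" and c :: int and \<G> :: "'a graph set"
  assumes "basic_hyperparameter \<rho>"
    and "inheritable \<rho>"
    and "graph_class \<G>"
  shows "(has_bounded \<G> (mu \<rho> c) \<longrightarrow> has_bounded \<G> (\<lambda>G. enat (card_value \<rho> G))) \<and>
    (has_bounded \<G> (alpha_mu \<rho> c) \<longrightarrow> has_bounded \<G> (\<lambda>G. enat (alpha_value \<rho> G))) \<and>
    (has_clique_bounded \<G> (mu \<rho> c) \<longrightarrow> has_clique_bounded \<G> (\<lambda>G. enat (card_value \<rho> G)))"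
proof (intro conjI impI)
  \<comment> \<open>Boundedness ranges over induced subgraphs, which may lie outside \<G>, whereas
    inheritability speaks of finite simple graphs only.\<close>
  have fin: "finite_simple_graph G'" if "G \<in> \<G>" "induced_subgraph G' G" for G G'
    using that assms(3) finite_simple_graph_induced_subgraph unfolding graph_class_def by blast
  show "has_bounded \<G> (\<lambda>G. enat (card_value \<rho> G))" if bd: "has_bounded \<G> (mu \<rho> c)"
  proof -
    obtain k where "\<forall>G\<in>\<G>. \<forall>G'. induced_subgraph G' G \<longrightarrow> mu \<rho> c G' \<le> enat k"
      using bd unfolding has_bounded_def by blast
    then have "\<forall>G\<in>\<G>. \<forall>G'. induced_subgraph G' G \<longrightarrow> card_value \<rho> G' \<le> nat c + k"
      using card_value_le_mu[OF assms(2)] fin by blast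
    then show ?thesis unfolding has_bounded_def enat_ord_simps by blast
  qed
  show "has_bounded \<G> (\<lambda>G. enat (alpha_value \<rho> G))" if bd: "has_bounded \<G> (alpha_mu \<rho> c)"
  proof -
    obtain k where "\<forall>G\<in>\<G>. \<forall>G'. induced_subgraph G' G \<longrightarrow> alpha_mu \<rho> c G' \<le> enat k"
      using bd unfolding has_bounded_def by blast
    then have "\<forall>G\<in>\<G>. \<forall>G'. induced_subgraph G' G \<longrightarrow> alpha_value \<rho> G' \<le> nat c + k"
      using alpha_value_le_alpha_mu[OF assms(2)] fin by blast
    then show ?thesis unfolding has_bounded_def enat_ord_simps by blast
  qed
  show "has_clique_bounded \<G> (\<lambda>G. enat (card_value \<rho> G))"
    if bd: "has_clique_bounded \<G> (mu \<rho> c)"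
  proof -
    obtain f where "mono f" and f: "\<forall>G\<in>\<G>. \<forall>G'. induced_subgraph G' G \<longrightarrow>
        mu \<rho> c G' \<le> enat (f (clique_number G'))"
      using bd unfolding has_clique_bounded_def by blast
    have "mono (\<lambda>n. nat c + f n)"
      using \<open>mono f\<close> by (auto simp: mono_def)
    \<comment> \<open>The constant \<open>k\<close> of \<open>card_value_le_mu\<close> may depend on
      the graph: for each \<open>G'\<close> it is taken to be
      \<open>f (clique_number G')\<close>.\<close>
    moreover have "\<forall>G\<in>\<G>. \<forall>G'. induced_subgraph G' G \<longrightarrow>
        card_value \<rho> G' \<le> nat c + f (clique_number G')"
      using card_value_le_mu[OF assms(2)] fin f by blast
    ultimately show ?thesis unfolding has_clique_bounded_def enat_ord_simps
      by (intro exI[of _ "\<lambda>n. nat c + f n"]) simp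
  qed
qed

end
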